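(* Let $d \ge 2$. For every $\mathbf{x} = (x_1,x_2,x_3) \in (\mathbb{R}^d)^3$ and every integer $k \ge 1$, $$N_+^{k+1}(\mathbf{x}) = (c(\mathbf{x}), c(\mathbf{x}), c(\mathbf{x})) \quad\text{and}\quad N_-^{k+2}(\mathbf{x}) = N_-^{k}(\mathbf{x}),$$ where $c(\mathbf{x}) = \frac13(x_1+x_2+x_3)$ and $N_\pm^k$ denotes the $k$-fold iterate of the inner ($+$), respectively outer ($-$), Napoleon transformation.
   Context: Throughout $d \ge 2$, $\|\cdot\|$ is the Euclidean norm on $\mathbb{R}^d$, and $\mathbf{x} = (x_1,x_2,x_3)$ with $x_i \in \mathbb{R}^d$ is identified with a vector of $\mathbb{R}^{3d}$. The triple is called trivial if $x_1=x_2=x_3$. Rotation matrix $R_{\mathbf{x}}$. For a trivial triple, $R_{\mathbf{x}} = 0$. Otherwise let $n = \frac{x_2-x_1}{\|x_2-x_1\|}$ if $x_1 \ne x_2$ and $n = \frac{x_3-x_2}{\|x_3-x_2\|}$ if $x_1=x_2$. If $\mathbf{x}$ is non-collinear, let $t$ be the unit vector in the direction of $(I_d - n n^{T})(x_3 - x_1)$; if $\mathbf{x}$ is collinear, let $t$ be an arbitrary (chosen and fixed for each $\mathbf{x}$) unit vector orthogonal to $n$. Set $$R_{\mathbf{x}} = [\,n,\ t\,]\begin{bmatrix} 0 & -1 \\ 1 & 0\end{bmatrix}[\,n,\ t\,]^{T},$$ i.e. the counter-clockwise rotation by $\pi/2$ in the plane spanned by $(n,t)$, oriented so that $(n,t)$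 is a positive basis; in this orientation a non-collinear $\mathbf{x}$ is positively (counter-clockwise) oriented. Torricelli transformations $T_\pm : \mathbb{R}^{3d} \to \mathbb{R}^{3d}$ ($+$ inner, $-$ outer). $T_\pm(\mathbf{x}) = (y_1,y_2,y_3)$, where for each cyclic permutation $(i,j,k)$ of $(1,2,3)$, $y_k$ is the new vertex of the equilateral triangle erected on the side $x_i x_j$ in the plane containing $\mathbf{x}$, inward for $+$ (on the same side of the line $x_ix_j$ as $x_k$) and outward for $-$ (on the opposite side). Precisely, and including the collinear case via the chosen plane and orientation, $y_k$ is the image of $x_j$ under rotation about $x_i$ by $60^\circ$, counter-clockwise for $+$ and clockwise for $-$: $$y_k = \tfrac12 (x_i + x_j) \pm \tfrac{\sqrt3}{2} R_{\mathbf{x}}(x_j - x_i).$$ Napoleon transformations $N_\pm : \mathbb{R}^{3d} \to \mathbb{R}^{3d}$ ($+$ inner, $-$ outer). $N_\pm(\mathbf{x}) = (z_1,z_2,z_3)$, where $z_k = \frac13(x_i + x_j + y_k)$ for $\{i,j,k\}=\{1,2,3\}$ is the centroid of the equilateral triangle erected on the side opposite $x_k$, with $(y_1,y_2,y_3) = T_\pm(\mathbf{x})$. Iterates: $N_\pm^0$ is the identity map and $N_\pm^{k+1} = N_\pm \circ N_\pm^{k}$. *)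

theory Defs
  imports "HOL-Analysis.Analysis"
begin

type_synonym 'd triple = "((real, 'd) vec, 3) vec"

definition trivial_triple :: "'d::finite triple \<Rightarrow> bool" where
  "trivial_triple x \<longleftrightarrow> x$1 = x$2 \<and> x$2 = x$3"

definition collinear_triple :: "'d::finite triple \<Rightarrow> bool" where
  "collinear_triple x \<longleftrightarrow> collinear {x$1, x$2, x$3}"

definition dir_n :: "'d::finite triple \<Rightarrow> real^'d" where
  "dir_n x = (if x$1 \<noteq> x$2 then (x$2 - x$1) /\<^sub>R norm (x$2 - x$1)
              else (x$3 - x$2) /\<^sub>R norm (x$3 - x$2))"

text \<open>For a collinear triple the second frame vector is an arbitrary unit vector orthogonal to
  the first one, chosen once and for all for each triple. The choice is a function \<open>\<tau>\<close>, which is a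
  parameter of everything below; its values at trivial and at non-collinear triples do not
  affect the matrix \<open>rot \<tau> x\<close>.\<close>

definition normal_choice :: "('d::finite triple \<Rightarrow> real^'d) \<Rightarrow> bool" where
  "normal_choice \<tau> \<longleftrightarrow>
     (\<forall>x. collinear_triple x \<and> \<not> trivial_triple x \<longrightarrow>
          norm (\<tau> x) = 1 \<and> orthogonal (dir_n x) (\<tau> x))"

definition dir_t :: "('d::finite triple \<Rightarrow> real^'d) \<Rightarrow> 'd triple \<Rightarrow> real^'d" where
  "dir_t \<tau> x =
     (if collinear_triple x then \<tau> x
      else (let n = dir_n x;
                w = (mat 1 - (columnvector n :: real^1^'d) ** rowvector n) *v (x$3 - x$1)
            in w /\<^sub>R norm w))"

definition two_columns :: "real^'d::finite \<Rightarrow> real^'d \<Rightarrow> real^2^'d" where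
  "two_columns u v = (\<chi> i. vector [u$i, v$i])"

definition rot :: "('d::finite triple \<Rightarrow> real^'d) \<Rightarrow> 'd triple \<Rightarrow> real^'d^'d" where
  "rot \<tau> x =
     (if trivial_triple x then 0
      else (let Q = two_columns (dir_n x) (dir_t \<tau> x);
                J = vector [vector [0, -1], vector [1, 0]] :: real^2^2
            in Q ** J ** transpose Q))"

text \<open>The real \<open>s\<close> is the sign: \<open>1\<close> gives the inner transformation, \<open>-1\<close> the outer one.\<close>

definition torricelli :: "real \<Rightarrow> ('d::finite triple \<Rightarrow> real^'d) \<Rightarrow> 'd triple \<Rightarrow> 'd triple" where
  "torricelli s \<tau> x =
     (let apex = (\<lambda>i j. (1/2) *\<^sub>R (x$i + x$j) + (s * sqrt 3 / 2) *\<^sub>R (rot \<tau> x *v (x$j - x$i)))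
      in vector [apex 2 3, apex 3 1, apex 1 2])"

definition napoleon :: "real \<Rightarrow> ('d::finite triple \<Rightarrow> real^'d) \<Rightarrow> 'd triple \<Rightarrow> 'd triple" where
  "napoleon s \<tau> x =
     (let y = torricelli s \<tau> x
      in vector [(1/3) *\<^sub>R (x$2 + x$3 + y$1),
                 (1/3) *\<^sub>R (x$3 + x$1 + y$2),
                 (1/3) *\<^sub>R (x$1 + x$2 + y$3)])"

abbreviation inner_napoleon :: "('d::finite triple \<Rightarrow> real^'d) \<Rightarrow> 'd triple \<Rightarrow> 'd triple" where
  "inner_napoleon \<equiv> napoleon 1"

abbreviation outer_napoleon :: "('d::finite triple \<Rightarrow> real^'d) \<Rightarrow> 'd triple \<Rightarrow> 'd triple" where
  "outer_napoleon \<equiv> napoleon (-1)"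

definition centroid :: "'d::finite triple \<Rightarrow> real^'d" where
  "centroid x = (1/3) *\<^sub>R (x$1 + x$2 + x$3)"

text \<open>In dimension at least two an admissible choice exists.\<close>

lemma normal_choice_exists:
  assumes "CARD('d::finite) \<ge> 2"
  shows "\<exists>\<tau> :: 'd triple \<Rightarrow> real^'d. normal_choice \<tau>"
proof -
  have "\<exists>t. norm t = 1 \<and> orthogonal u t" for u :: "real^'d"
  proof -
    have "2 \<le> DIM(real^'d)"
      using assms by simp
    then obtain y where "y \<noteq> 0" "orthogonal u y"
      by (rule orthogonal_to_vector_exists)
    then have "norm (y /\<^sub>R norm y) = 1 \<and> orthogonal u (y /\<^sub>R norm y)"
      by (simp add: orthogonal_def)
    then show ?thesis by blast
  qed
  then have "normal_choice (\<lambda>x :: 'd triple. SOME t. norm t = 1 \<and> orthogonal (dir_n x) t)"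
    unfolding normal_choice_def by (metis (mono_tags, lifting) someI_ex)
  then show ?thesis by blast
qed

end

theory Submission
  imports Defs
begin

text \<open>One application of either Napoleon transformation gives an equilateral triangle with the same
  centroid. A non-trivial triangle is always positively oriented with respect to its own frame,
  so the inner transformation collapses an equilateral triangle to its centroid, while the outer
  one reflects it in its centroid; the reflected triangle is again equilateral.\<close>

text \<open>Trivial triples count as equilateral of side 0, so the degenerate images need no
  separate treatment later.\<close>

definition equilateral :: "'d::finite triple \<Rightarrow> bool" where
  "equilateral x \<longleftrightarrow> norm (x$3 - x$1) = norm (x$2 - x$1) \<and> norm (x$3 - x$2) = norm (x$2 - x$1)"

lemma triple_eqI:
  fixes x y :: "'d::finite triple"
  assumes "x$1 = y$1" "x$2 = y$2" "x$3 = y$3"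
  shows "x = y"
  using assms by (simp add: vec_eq_iff forall_3)

text \<open>\<open>transpose Q\<close> reads off the inner products (a, b) of \<open>v\<close> with
  \<open>n\<close> and \<open>t\<close>, the 2x2 block turns (a, b) into (-b, a), and
  \<open>Q\<close> recombines the columns. For orthonormal \<open>n\<close>, \<open>t\<close> this
  is the quarter turn sending \<open>n\<close> to \<open>t\<close> and \<open>t\<close> to
  \<open>-n\<close>.\<close>

lemma frame_rotation_mult:
  fixes n t v :: "real^'d::finite"
  defines "Q \<equiv> two_columns n t"
  shows "(Q ** (vector [vector [0, -1], vector [1, 0]] :: real^2^2) ** transpose Q) *v v
         = (n \<bullet> v) *\<^sub>R t - (t \<bullet> v) *\<^sub>R n"
proof -
  have "transpose Q *v v = vector [n \<bullet> v, t \<bullet> v]"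
    by (simp add: vec_eq_iff forall_2 Q_def two_columns_def transpose_def
        matrix_vector_mult_def inner_vec_def)
  then show ?thesis
    by (simp only: matrix_vector_mul_assoc[symmetric])
       (simp add: vec_eq_iff Q_def two_columns_def matrix_vector_mult_def sum_2)
qed

lemma projection_mult:
  fixes n v :: "real^'d::finite"
  shows "(mat 1 - (columnvector n :: real^1^'d) ** rowvector n) *v v = v - (n \<bullet> v) *\<^sub>R n"
proof -
  have "((columnvector n :: real^1^'d) ** rowvector n) *v v = (n \<bullet> v) *\<^sub>R n"
    by (simp add: vec_eq_iff columnvector_def rowvector_def matrix_matrix_mult_def
        matrix_vector_mult_def inner_vec_def sum_distrib_left sum_distrib_right mult_ac)
  then show ?thesis
    by (simp add: matrix_vector_mult_diff_rdistrib)
qed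

text \<open>Puts collinear and non-collinear triples into one normal form with origin
  \<open>x$1\<close>, so that non-trivial triples can be handled by real coordinates
  \<open>r\<close>, \<open>p\<close>, \<open>q\<close>. The condition \<open>q \<ge> 0\<close>
  records that a triple is never negatively oriented in its own frame.\<close>

lemma frame_coordinates:
  fixes x :: "'d::finite triple"
  assumes "normal_choice \<tau>" and "\<not> trivial_triple x"
  obtains n t :: "real^'d" and r p q :: real
  where "norm n = 1" "norm t = 1" "n \<bullet> t = 0" "r \<ge> 0" "q \<ge> 0"
    "x$2 = x$1 + r *\<^sub>R n" "x$3 = x$1 + p *\<^sub>R n + q *\<^sub>R t"
    "\<And>v. rot \<tau> x *v v = (n \<bullet> v) *\<^sub>R t - (t \<bullet> v) *\<^sub>R n"
proof -
  define n where "n = dir_n x"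
  define t where "t = dir_t \<tau> x"
  define r where "r = norm (x$2 - x$1)"
  have n: "norm n = 1"
    using assms(2) by (auto simp: n_def dir_n_def trivial_triple_def)
  have x2: "x$2 = x$1 + r *\<^sub>R n"
    by (auto simp: n_def dir_n_def r_def)
  have rot: "rot \<tau> x *v v = (n \<bullet> v) *\<^sub>R t - (t \<bullet> v) *\<^sub>R n" for v
    using assms(2) by (simp add: rot_def Let_def frame_rotation_mult n_def t_def)
  show ?thesis
  proof (cases "collinear_triple x")
    case True
    then have t: "norm t = 1" "n \<bullet> t = 0"
      using assms by (auto simp: normal_choice_def t_def dir_t_def n_def orthogonal_def)
    have "\<exists>p. x$3 = x$1 + p *\<^sub>R n"
    proof (cases "x$1 = x$2")
      case True
      with assms(2) have "x$3 \<noteq> x$2"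
        by (auto simp: trivial_triple_def)
      with True show ?thesis
        by (intro exI[of _ "norm (x$3 - x$2)"]) (simp add: n_def dir_n_def)
    next
      case False
      \<comment> \<open>\<open>collinear_3_expand\<close> solves for the middle point, so
        \<open>x$3\<close> is moved there.\<close>
      have "collinear {x$1, x$3, x$2}"
        using True by (simp add: collinear_triple_def insert_commute)
      then obtain u where "x$3 = u *\<^sub>R x$1 + (1 - u) *\<^sub>R x$2"
        using False by (auto simp: collinear_3_expand)
      also have "\<dots> = x$1 + ((1 - u) * r) *\<^sub>R n"
        by (subst x2) (simp add: algebra_simps)
      finally show ?thesis by blast
    qed
    \<comment> \<open>In the collinear case \<open>q = 0\<close>, so every admissible choice of
      \<open>t\<close> gives the same coordinates.\<close>
    then obtain p where "x$3 = x$1 + p *\<^sub>R n + 0 *\<^sub>R t"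
      by auto
    with n t x2 rot show ?thesis
      by (intro that[of n t r 0 p]) (auto simp: r_def)
  next
    case False
    define w where "w = x$3 - x$1 - (n \<bullet> (x$3 - x$1)) *\<^sub>R n"
    have t: "t = w /\<^sub>R norm w"
      using False by (simp add: t_def dir_t_def Let_def projection_mult w_def n_def)
    \<comment> \<open>Otherwise all three points lie on the line through \<open>x$1\<close> with
      direction \<open>n\<close>. Hence \<open>w\<close> can be normalised, and
      \<open>q = norm w\<close> is nonnegative.\<close>
    have "w \<noteq> 0"
    proof
      assume "w = 0"
      then have "x$3 = x$1 + (n \<bullet> (x$3 - x$1)) *\<^sub>R n"
        by (simp add: w_def algebra_simps)
      then have "\<exists>p. x$3 = x$1 + p *\<^sub>R n" by blast
      moreover have "x$1 = x$1 + 0 *\<^sub>R n" by simp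
      ultimately have "collinear {x$1, x$2, x$3}"
        using x2 unfolding collinear_alt by blast
      with False show False
        by (simp add: collinear_triple_def)
    qed
    have "n \<bullet> n = 1"
      using n by (simp add: norm_eq_1)
    then have "n \<bullet> w = 0"
      by (simp add: w_def inner_diff_right)
    moreover have "x$3 = x$1 + (n \<bullet> (x$3 - x$1)) *\<^sub>R n + norm w *\<^sub>R t"
      using \<open>w \<noteq> 0\<close> by (simp add: t) (simp add: w_def)
    ultimately show ?thesis
      using n x2 rot \<open>w \<noteq> 0\<close>
      by (intro that[of n t r "norm w" "n \<bullet> (x$3 - x$1)"]) (auto simp: r_def t)
  qed
qed

text \<open>The centroid of an equilateral triangle lies above the midpoint of its base at a third
  of the height, which turns the factor \<open>sqrt 3 / 2\<close> into
  \<open>sqrt 3 / 6\<close>.\<close>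

lemma napoleon_eq:
  fixes x :: "'d::finite triple"
  shows "napoleon s \<tau> x = vector
    [(1/2) *\<^sub>R (x$2 + x$3) + (s * sqrt 3 / 6) *\<^sub>R (rot \<tau> x *v (x$3 - x$2)),
     (1/2) *\<^sub>R (x$3 + x$1) + (s * sqrt 3 / 6) *\<^sub>R (rot \<tau> x *v (x$1 - x$3)),
     (1/2) *\<^sub>R (x$1 + x$2) + (s * sqrt 3 / 6) *\<^sub>R (rot \<tau> x *v (x$2 - x$1))]"
proof -
  have "(1/3::real) *\<^sub>R (a + b + ((1/2) *\<^sub>R (a + b) + (s * sqrt 3 / 2) *\<^sub>R c))
      = (1/2) *\<^sub>R (a + b) + (s * sqrt 3 / 6) *\<^sub>R c" for a b c :: "real^'d"
    by (simp add: vec_eq_iff field_simps)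
  then show ?thesis
    by (simp add: napoleon_def torricelli_def)
qed

lemma napoleon_trivial:
  fixes x :: "'d::finite triple"
  assumes "trivial_triple x"
  shows "napoleon s \<tau> x = x"
  using assms
  by (intro triple_eqI) (auto simp: napoleon_eq trivial_triple_def rot_def simp flip: scaleR_2)

lemma napoleon_frame:
  fixes x :: "'d::finite triple" and n t :: "real^'d" and s :: real
  assumes "norm n = 1" "norm t = 1" "n \<bullet> t = 0"
    and "x$2 = x$1 + r *\<^sub>R n" "x$3 = x$1 + p *\<^sub>R n + q *\<^sub>R t"
    and "\<And>v. rot \<tau> x *v v = (n \<bullet> v) *\<^sub>R t - (t \<bullet> v) *\<^sub>R n"
  defines "k \<equiv> s * sqrt 3 / 6"
  shows "napoleon s \<tau> x = vector
    [x$1 + ((r + p) / 2 - k * q) *\<^sub>R n + (q / 2 + k * (p - r)) *\<^sub>R t,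
     x$1 + (p / 2 + k * q) *\<^sub>R n + (q / 2 - k * p) *\<^sub>R t,
     x$1 + (r / 2) *\<^sub>R n + (k * r) *\<^sub>R t]"
proof -
  have [simp]: "n \<bullet> n = 1" "t \<bullet> t = 1" "t \<bullet> n = 0"
    using assms(1-3) by (simp_all add: norm_eq_1 inner_commute)
  show ?thesis
    unfolding napoleon_eq k_def[symmetric] assms(6)
    by (intro triple_eqI; simp add: assms(3-5) inner_diff_right inner_add_right)
       (simp_all add: vec_eq_iff field_simps)
qed

text \<open>The three side vectors sum to zero, so their images under the linear map
  \<open>rot \<tau> x\<close> cancel and only the midpoints contribute.\<close>

lemma centroid_napoleon:
  fixes x :: "'d::finite triple"
  shows "centroid (napoleon s \<tau> x) = centroid x"
  by (simp add: centroid_def napoleon_eq matrix_vector_mult_diff_distrib)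
     (simp add: vec_eq_iff field_simps)

lemma norm_orthonormal:
  fixes n t :: "'a::real_inner"
  assumes "norm n = 1" "norm t = 1" "n \<bullet> t = 0"
  shows "norm (a *\<^sub>R n + b *\<^sub>R t) = sqrt (a\<^sup>2 + b\<^sup>2)"
  using assms
  by (simp add: norm_eq_sqrt_inner inner_add_left inner_add_right inner_commute power2_eq_square)

text \<open>Napoleon's theorem, by comparing squared side lengths in frame coordinates. The terms
  linear in \<open>k\<close> agree for all three sides, so only the square of the sign matters and
  both transformations are covered at once.\<close>

lemma equilateral_napoleon:
  fixes x :: "'d::finite triple"
  assumes "normal_choice \<tau>" and "s\<^sup>2 = 1"
  shows "equilateral (napoleon s \<tau> x)"
proof (cases "trivial_triple x")
  case True
  then show ?thesis
    by (simp add: napoleon_trivial) (simp add: equilateral_def trivial_triple_def)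
next
  case False
  then obtain n t r p q where f: "norm n = 1" "norm t = 1" "n \<bullet> t = 0" "r \<ge> 0" "q \<ge> 0"
    "x$2 = x$1 + r *\<^sub>R n" "x$3 = x$1 + p *\<^sub>R n + q *\<^sub>R t"
    "\<And>v. rot \<tau> x *v v = (n \<bullet> v) *\<^sub>R t - (t \<bullet> v) *\<^sub>R n"
    by (rule frame_coordinates[OF assms(1)]) (rule that)
  define k where "k = s * sqrt 3 / 6"
  define z where "z = napoleon s \<tau> x"
  have k: "12 * k\<^sup>2 = 1"
    using assms(2) by (simp add: k_def power_mult_distrib power_divide)
  have z: "z = vector
    [x$1 + ((r + p) / 2 - k * q) *\<^sub>R n + (q / 2 + k * (p - r)) *\<^sub>R t,
     x$1 + (p / 2 + k * q) *\<^sub>R n + (q / 2 - k * p) *\<^sub>R t,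
     x$1 + (r / 2) *\<^sub>R n + (k * r) *\<^sub>R t]"
    unfolding z_def k_def by (rule napoleon_frame[OF f(1-3,6-8)])
  have "z$2 - z$1 = (2 * k * q - r / 2) *\<^sub>R n + (k * r - 2 * k * p) *\<^sub>R t"
    "z$3 - z$1 = (k * q - p / 2) *\<^sub>R n + (2 * k * r - k * p - q / 2) *\<^sub>R t"
    "z$3 - z$2 = (r / 2 - p / 2 - k * q) *\<^sub>R n + (k * r + k * p - q / 2) *\<^sub>R t"
    by (simp_all add: z vec_eq_iff algebra_simps)
  \<comment> \<open>The differences of the squared lengths are isolated as multiples of
    \<open>12 * k\<^sup>2 - 1\<close>, which vanishes by the choice of \<open>k\<close>.\<close>
  moreover have "(k * q - p / 2)\<^sup>2 + (2 * k * r - k * p - q / 2)\<^sup>2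
      = (2 * k * q - r / 2)\<^sup>2 + (k * r - 2 * k * p)\<^sup>2
        + (12 * k\<^sup>2 - 1) * (r\<^sup>2 - q\<^sup>2 - p\<^sup>2) / 4"
    "(r / 2 - p / 2 - k * q)\<^sup>2 + (k * r + k * p - q / 2)\<^sup>2
      = (2 * k * q - r / 2)\<^sup>2 + (k * r - 2 * k * p)\<^sup>2
        + (12 * k\<^sup>2 - 1) * (2 * r * p - q\<^sup>2 - p\<^sup>2) / 4"
    by (simp_all add: power2_eq_square field_simps)
  ultimately show ?thesis
    using f(1-3) k by (simp add: equilateral_def norm_orthonormal flip: z_def)
qed

lemma equilateral_frame_coordinates:
  fixes x :: "'d::finite triple"
  assumes "normal_choice \<tau>" and "\<not> trivial_triple x" and "equilateral x"
  obtains n t :: "real^'d" and r :: real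
  where "norm n = 1" "norm t = 1" "n \<bullet> t = 0"
    "x$2 = x$1 + r *\<^sub>R n" "x$3 = x$1 + (r / 2) *\<^sub>R n + (sqrt 3 / 2 * r) *\<^sub>R t"
    "\<And>v. rot \<tau> x *v v = (n \<bullet> v) *\<^sub>R t - (t \<bullet> v) *\<^sub>R n"
proof -
  obtain n t r p q where f: "norm n = 1" "norm t = 1" "n \<bullet> t = 0" "r \<ge> 0" "q \<ge> 0"
    "x$2 = x$1 + r *\<^sub>R n" "x$3 = x$1 + p *\<^sub>R n + q *\<^sub>R t"
    "\<And>v. rot \<tau> x *v v = (n \<bullet> v) *\<^sub>R t - (t \<bullet> v) *\<^sub>R n"
    by (rule frame_coordinates[OF assms(1,2)]) (rule that)
  have "x$2 - x$1 = r *\<^sub>R n + 0 *\<^sub>R t" "x$3 - x$1 = p *\<^sub>R n + q *\<^sub>R t"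
    "x$3 - x$2 = (p - r) *\<^sub>R n + q *\<^sub>R t"
    by (simp_all add: f(6,7) algebra_simps)
  then have e: "p\<^sup>2 + q\<^sup>2 = r\<^sup>2" "(p - r)\<^sup>2 + q\<^sup>2 = r\<^sup>2"
    using assms(3) norm_orthonormal[OF f(1-3)] unfolding equilateral_def
    by (metis add_0_right power_zero_numeral real_sqrt_eq_iff)+
  then have "r * (2 * p - r) = 0"
    by algebra
  \<comment> \<open>If \<open>r = 0\<close>, the first equation of \<open>e\<close> forces
    \<open>p = 0\<close>; otherwise \<open>r\<close> cancels.\<close>
  with e(1) have p: "p = r / 2"
    by auto
  with e(1) have "q\<^sup>2 = (sqrt 3 / 2 * r)\<^sup>2"
    by (simp add: power_mult_distrib power_divide)
  \<comment> \<open>Orientation enters here: \<open>q\<close> and \<open>r\<close> are nonnegative,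
    so the positive root is taken. This sign is what separates the inner from the outer
    transformation.\<close>
  with f(4,5) have "q = sqrt 3 / 2 * r"
    by (simp add: power2_eq_iff_nonneg)
  with p f show ?thesis
    using that by blast
qed

text \<open>Erecting an equilateral triangle inwards on a side of an equilateral triangle gives back
  the same triangle, so all three new centres coincide with the old one.\<close>

lemma inner_napoleon_equilateral:
  fixes x :: "'d::finite triple"
  assumes "normal_choice \<tau>" and "equilateral x"
  shows "inner_napoleon \<tau> x = vector [centroid x, centroid x, centroid x]"
proof (cases "trivial_triple x")
  case True
  then show ?thesis
    by (intro triple_eqI)
       (simp_all add: napoleon_trivial, auto simp: trivial_triple_def centroid_def vec_eq_iff)
next
  case False
  then obtain n t r where f: "norm n = 1" "norm t = 1" "n \<bullet> t = 0"
    "x$2 = x$1 + r *\<^sub>R n" "x$3 = x$1 + (r / 2) *\<^sub>R n + (sqrt 3 / 2 * r) *\<^sub>R t"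
    "\<And>v. rot \<tau> x *v v = (n \<bullet> v) *\<^sub>R t - (t \<bullet> v) *\<^sub>R n"
    by (rule equilateral_frame_coordinates[OF assms(1) _ assms(2)]) (rule that)
  show ?thesis
    unfolding napoleon_frame[OF f]
    by (intro triple_eqI; simp add: centroid_def f(4,5)) (simp_all add: vec_eq_iff field_simps)
qed

text \<open>Let c be the centroid and m the midpoint of the side opposite \<open>x $ i\<close>. The
  outer centre is c reflected in m, that is 2m - c, and 3c = 2m + \<open>x $ i\<close> rewrites this
  as a reflection of \<open>x $ i\<close> in c.\<close>

lemma outer_napoleon_equilateral:
  fixes x :: "'d::finite triple"
  assumes "normal_choice \<tau>" and "equilateral x"
  shows "outer_napoleon \<tau> x $ i = 2 *\<^sub>R centroid x - x $ i"
proof (cases "trivial_triple x")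
  case True
  then have "\<forall>i. x $ i = 2 *\<^sub>R centroid x - x $ i"
    by (auto simp: trivial_triple_def centroid_def vec_eq_iff forall_3)
  with True show ?thesis
    by (simp add: napoleon_trivial)
next
  case False
  then obtain n t r where f: "norm n = 1" "norm t = 1" "n \<bullet> t = 0"
    "x$2 = x$1 + r *\<^sub>R n" "x$3 = x$1 + (r / 2) *\<^sub>R n + (sqrt 3 / 2 * r) *\<^sub>R t"
    "\<And>v. rot \<tau> x *v v = (n \<bullet> v) *\<^sub>R t - (t \<bullet> v) *\<^sub>R n"
    by (rule equilateral_frame_coordinates[OF assms(1) _ assms(2)]) (rule that)
  have "\<forall>i. outer_napoleon \<tau> x $ i = 2 *\<^sub>R centroid x - x $ i"
    unfolding napoleon_frame[OF f]
    by (simp add: centroid_def f(4,5) forall_3) (simp add: vec_eq_iff field_simps)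
  then show ?thesis ..
qed

text \<open>The image may have a different frame, but the reflection formula mentions only the
  centroid. As the image is equilateral with the same centroid, the second application undoes the
  first.\<close>

lemma outer_napoleon_twice_equilateral:
  fixes x :: "'d::finite triple"
  assumes "normal_choice \<tau>" and "equilateral x"
  shows "outer_napoleon \<tau> (outer_napoleon \<tau> x) = x"
  by (rule triple_eqI)
     (simp_all add: outer_napoleon_equilateral equilateral_napoleon centroid_napoleon assms)

theorem lemma3:
  fixes x :: "'d::finite triple" and \<tau> :: "'d triple \<Rightarrow> real^'d" and k :: nat
  assumes "CARD('d) \<ge> 2"
    and "normal_choice \<tau>"
    and "k \<ge> 1"
  shows "(inner_napoleon \<tau> ^^ (k + 1)) x = vector [centroid x, centroid x, centroid x]
       \<and> (outer_napoleon \<tau> ^^ (k + 2)) x = (outer_napoleon \<tau> ^^ k) x"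
proof
  \<comment> \<open>Since \<open>k \<ge> 1\<close>, the \<open>k\<close>-th iterate is the image of
    some triple; its outermost application alone makes it equilateral, whatever the earlier iterates
    are.\<close>
  obtain j where k: "k = Suc j"
    using assms(3) by (cases k) auto
  have centroid: "centroid ((inner_napoleon \<tau> ^^ m) x) = centroid x" for m
    by (induction m) (simp_all add: centroid_napoleon)
  have equilateral: "equilateral ((napoleon s \<tau> ^^ k) x)" if "s\<^sup>2 = 1" for s
    using that by (simp add: k equilateral_napoleon assms(2))
  show "(inner_napoleon \<tau> ^^ (k + 1)) x = vector [centroid x, centroid x, centroid x]"
    using inner_napoleon_equilateral[OF assms(2) equilateral[of 1]] by (simp add: centroid)
  show "(outer_napoleon \<tau> ^^ (k + 2)) x = (outer_napoleon \<tau> ^^ k) x"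
    using outer_napoleon_twice_equilateral[OF assms(2) equilateral[of "-1"]] by simp
qed

end
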